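(* Let $\Omega=\{1,\dots,n\}$, let $N$ be a positive integer and $\pi\in[1,\infty]$, with $\pi_*=\pi/(\pi-1)$ the conjugate exponent. Let $\rho_{\beta,n,\pi}(N)$ be any quantity such that for every probability distribution $f$ on $\Omega$, the empirical distribution $\hat f[x^N]$ of an $N$-element i.i.d. sample $x^N$ drawn from $f$ satisfies $\mathbb P\{\|\hat f[x^N]-f\|_\pi>\rho_{\beta,n,\pi}(N)\}\le\beta$. Let $X^1$, $X^2$ be independent samples of cardinality $2N$ each, i.i.d. from distributions $p$ and $q$ on $\Omega$ respectively. Split $X^1$ into non-overlapping subsamples $x^{\mathrm{tr}},x^{\mathrm{ts}}$ of cardinality $N$ each and $X^2$ into non-overlapping $\bar x^{\mathrm{tr}},\bar x^{\mathrm{ts}}$ of cardinality $N$ each, and let $\hat f[\cdot]$ denote empirical distributions. Using only $(x^{\mathrm{tr}},\bar x^{\mathrm{tr}})$, choose $e\in\mathbb R^n$ with $e^T(\hat f[x^{\mathrm{tr}}]-\hat f[\bar x^{\mathrm{tr}}])=\|\hat f[x^{\mathrm{tr}}]-\hat f[\bar x^{\mathrm{tr}}]\|_\pi$ and $\|e\|_{\pi_*}=1$, and set $h=e/\|e\|_\infty$. Let $\chi=h^T(\hat f[x^{\mathrm{ts}}]-\hat f[\bar x^{\mathrm{ts}}])$. For $\alpha\in(0,1)$ let $\tau_N(\alpha)$ be the positive root of $\dfrac{\tau^2}{1+\frac23\tau}=\dfrac2N\ln(2/\alpha)$, let $\tau'_N(\alpha)=\min\{1,\tau_N(\alpha)\}$,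 and let the test $\mathcal T^N_{\pi,\alpha}$ claim $H_1$ if and only if $\chi>\ell:=2\tau'_N(\alpha)$. Then: (1) if $p=q$, the probability that $\mathcal T^N_{\pi,\alpha}$ claims $H_1$ is at most $\alpha$; (2) for $\beta\in(0,1/4)$, if $\|p-q\|_\pi\ge6\rho_{\beta,n,\pi}(N)+2\tau'_N(\alpha)$, then the probability that $\mathcal T^N_{\pi,\alpha}$ does not claim $H_1$ is at most $4\beta$.
   Context: The empirical distribution of a set of observations in $\{1,\dots,n\}$ is the vector of relative frequencies. *)

theory Defs
  imports "HOL-Probability.Probability"
begin

text \<open>Omega = {1..n}; vectors in R^n are functions nat => real, only indices 1..n matter.\<close>

definition lpnorm :: "nat \<Rightarrow> ereal \<Rightarrow> (nat \<Rightarrow> real) \<Rightarrow> real" where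
  "lpnorm n pp v =
     (if pp = \<infinity> then Max ((\<lambda>i. \<bar>v i\<bar>) ` {1..n})
      else (\<Sum>i=1..n. \<bar>v i\<bar> powr real_of_ereal pp) powr (1 / real_of_ereal pp))"

definition conj_exp :: "ereal \<Rightarrow> ereal" where
  "conj_exp pp = (if pp = 1 then \<infinity> else if pp = \<infinity> then 1
                  else ereal (real_of_ereal pp / (real_of_ereal pp - 1)))"

definition emp :: "nat \<Rightarrow> (nat \<Rightarrow> nat) \<Rightarrow> nat \<Rightarrow> real" where
  "emp N x i = real (card {k\<in>{..<N}. x k = i}) / real N"

definition sample_pmf :: "nat \<Rightarrow> nat pmf \<Rightarrow> (nat \<Rightarrow> nat) pmf" where
  "sample_pmf m f = Pi_pmf {..<m} 0 (\<lambda>_. f)"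

definition tauN :: "nat \<Rightarrow> real \<Rightarrow> real" where
  "tauN N \<alpha> = (THE t. t > 0 \<and> t\<^sup>2 / (1 + 2/3 * t) = 2 / real N * ln (2 / \<alpha>))"

definition tauN' :: "nat \<Rightarrow> real \<Rightarrow> real" where
  "tauN' N \<alpha> = min 1 (tauN N \<alpha>)"

definition train :: "nat \<Rightarrow> (nat \<Rightarrow> nat) \<Rightarrow> nat \<Rightarrow> nat" where
  "train N X = (\<lambda>k. if k < N then X k else 0)"

definition test :: "nat \<Rightarrow> (nat \<Rightarrow> nat) \<Rightarrow> nat \<Rightarrow> nat" where
  "test N X = (\<lambda>k. if k < N then X (N + k) else 0)"

text \<open>The statistic chi; e is the (training-based) choice of the dual vector.\<close>
definition chi :: "nat \<Rightarrow> nat \<Rightarrow> ((nat \<Rightarrow> nat) \<Rightarrow> (nat \<Rightarrow> nat) \<Rightarrow> nat \<Rightarrow> real)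
                   \<Rightarrow> (nat \<Rightarrow> nat) \<Rightarrow> (nat \<Rightarrow> nat) \<Rightarrow> real" where
  "chi n N e X Y =
     (let ev = e (train N X) (train N Y);
          h = (\<lambda>i. ev i / lpnorm n \<infinity> ev)
      in (\<Sum>i=1..n. h i * (emp N (test N X) i - emp N (test N Y) i)))"

definition claims_H1 :: "nat \<Rightarrow> nat \<Rightarrow> ((nat \<Rightarrow> nat) \<Rightarrow> (nat \<Rightarrow> nat) \<Rightarrow> nat \<Rightarrow> real)
                   \<Rightarrow> real \<Rightarrow> (nat \<Rightarrow> nat) \<Rightarrow> (nat \<Rightarrow> nat) \<Rightarrow> bool" where
  "claims_H1 n N e \<alpha> X Y \<longleftrightarrow> chi n N e X Y > 2 * tauN' N \<alpha>"

end

theory Submission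
  imports Defs
begin

text \<open>
  Conditionally on the training samples the vector \<open>h\<close> is fixed with entries in \<open>[-1, 1]\<close>.
  Under \<open>p = q\<close> the statistic is a difference of two centred averages of \<open>N\<close> terms; Hoeffding's
  inequality with deviation \<open>\<tau>\<close> bounds each tail by \<open>exp (- N \<tau>\<^sup>2 / 2)\<close>, which is at most \<open>\<alpha> / 2\<close>
  because the equation for \<open>\<tau>\<close> forces \<open>N \<tau>\<^sup>2 \<ge> 2 ln (2 / \<alpha>)\<close>. If \<open>\<tau> \<ge> 1\<close>, the threshold is 2, which
  the statistic never exceeds.

  For the second claim, the triangle and Hoelder inequalities on the event that all four
  empirical distributions are \<open>\<rho>\<close>-close to the truth give only \<open>\<chi> \<ge> 2 \<tau>'\<close>, whereas the test needs
  a strict inequality. The gap is closed by showing, for each fixed dual vector \<open>e\<close>, that even the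
  non-strict deviation \<open>e\<^sup>T (f' - p) \<ge> \<rho>\<close> of the empirical distribution \<open>f'\<close> has probability at
  most \<open>\<beta>\<close>. For this, mix \<open>p\<close> with a little mass \<open>\<epsilon>\<close> at a minimiser of \<open>e\<close>: this makes the
  deviation strict, so the assumption on \<open>\<rho>\<close> applies to the mixture, and it changes probabilities
  by a factor of at least \<open>(1 - \<epsilon>)^N\<close>, which tends to 1. If all the mass of \<open>p\<close> already sits on
  minimisers, the deviation vanishes, and it suffices that \<open>\<rho> > 0\<close>.
\<close>

section \<open>The norms on R^n: Minkowski and Hoelder inequalities\<close>

lemma lpnorm_infty: "lpnorm n \<infinity> v = Max ((\<lambda>i. \<bar>v i\<bar>) ` {1..n})"
  by (simp add: lpnorm_def)

lemma lpnorm_ereal: "lpnorm n (ereal r) v = (\<Sum>i=1..n. \<bar>v i\<bar> powr r) powr (1 / r)"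
  by (simp add: lpnorm_def)

lemma lpnorm_one: "lpnorm n 1 v = (\<Sum>i=1..n. \<bar>v i\<bar>)"
  by (simp add: lpnorm_def sum_nonneg)

lemma lpnorm_ereal_powr:
  assumes "r \<ge> 1"
  shows "lpnorm n (ereal r) v powr r = (\<Sum>i=1..n. \<bar>v i\<bar> powr r)"
  using assms by (simp add: lpnorm_ereal powr_powr sum_nonneg)

lemma ereal_ge_1_cases:
  fixes pp :: ereal
  assumes "pp \<ge> 1"
  obtains (infty) "pp = \<infinity>" | (real) r where "pp = ereal r" "r \<ge> 1"
  using assms by (cases pp) auto

lemma abs_le_lpnorm:
  assumes "pp \<ge> 1" "i \<in> {1..n}"
  shows "\<bar>v i\<bar> \<le> lpnorm n pp v"
  using assms(1)
proof (cases rule: ereal_ge_1_cases)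
  case infty
  then show ?thesis using assms(2) by (auto simp: lpnorm_infty intro!: Max_ge)
next
  case (real r)
  have "\<bar>v i\<bar> powr r \<le> (\<Sum>i=1..n. \<bar>v i\<bar> powr r)"
    using assms(2) by (intro member_le_sum) auto
  then have "(\<bar>v i\<bar> powr r) powr (1/r) \<le> (\<Sum>i=1..n. \<bar>v i\<bar> powr r) powr (1/r)"
    using real by (intro powr_mono2) auto
  then show ?thesis using real by (simp add: lpnorm_ereal powr_powr)
qed

lemma lpnorm_nonneg:
  assumes "pp \<ge> 1" "n \<ge> 1"
  shows "lpnorm n pp v \<ge> 0"
  using abs_le_lpnorm[of pp 1 n v] assms by auto

lemma lpnorm_cong:
  assumes "\<And>i. i \<in> {1..n} \<Longrightarrow> \<bar>u i\<bar> = \<bar>v i\<bar>"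
  shows "lpnorm n pp u = lpnorm n pp v"
proof -
  have "(\<lambda>i. \<bar>u i\<bar>) ` {1..n} = (\<lambda>i. \<bar>v i\<bar>) ` {1..n}"
    using assms by (intro image_cong) auto
  moreover have "(\<Sum>i=1..n. \<bar>u i\<bar> powr real_of_ereal pp) = (\<Sum>i=1..n. \<bar>v i\<bar> powr real_of_ereal pp)"
    using assms by (intro sum.cong) auto
  ultimately show ?thesis by (simp only: lpnorm_def)
qed

lemma lpnorm_minus_commute: "lpnorm n pp (\<lambda>i. u i - v i) = lpnorm n pp (\<lambda>i. v i - u i)"
  by (intro lpnorm_cong) (simp add: abs_minus_commute)

lemma lpnorm_uminus: "lpnorm n pp (\<lambda>i. - v i) = lpnorm n pp v"
  by (intro lpnorm_cong) simp

lemma lpnorm_zero: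
  assumes "pp \<ge> 1" "n \<ge> 1"
  shows "lpnorm n pp (\<lambda>i. 0) = 0"
  using assms by (cases rule: ereal_ge_1_cases) (auto simp: lpnorm_def)

text \<open>For positive \<open>a\<close> and \<open>b\<close> this is convexity of the power
  function. If one of them is 0, what remains is \<open>c powr r \<le> c\<close> for
  \<open>c\<close> in [0, 1].\<close>

lemma powr_convex_combination:
  fixes a b l r :: real
  assumes "r \<ge> 1" "a \<ge> 0" "b \<ge> 0" "0 < l" "l < 1"
  shows "(l * a + (1 - l) * b) powr r \<le> l * a powr r + (1 - l) * b powr r"
proof -
  have scale: "(c * x) powr r \<le> c * x powr r" if "0 \<le> c" "c \<le> 1" "x \<ge> 0" for c x :: real
  proof -
    have "c powr r \<le> c" using powr_mono'[of 1 r c] that assms(1) by (cases "c = 0") auto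
    then show ?thesis using that by (simp add: powr_mult mult_right_mono)
  qed
  consider "a = 0" | "b = 0" | "a > 0" "b > 0" using assms by linarith
  then show ?thesis
  proof cases
    case 1 then show ?thesis using scale[of "1-l" b] assms by simp
  next
    case 2 then show ?thesis using scale[of l a] assms by simp
  next
    case 3
    have "((1 - (1-l)) *\<^sub>R a + (1-l) *\<^sub>R b) powr r \<le> (1 - (1-l)) * a powr r + (1-l) * b powr r"
      using 3 assms by (intro convex_onD[OF powr_convex]) auto
    then show ?thesis by simp
  qed
qed

text \<open>Minkowski's inequality from convexity of the r-th power: |u i| + |v i| is
  \<open>A + B\<close> times the convex combination, with weight A / (A + B), of |u i| / A and |v i|
  / B, and the r-th powers of each of these sum to 1 over i.\<close>

lemma lpnorm_triangle:
  assumes "pp \<ge> 1" "n \<ge> 1"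
  shows "lpnorm n pp (\<lambda>i. u i + v i) \<le> lpnorm n pp u + lpnorm n pp v"
  using assms(1)
proof (cases rule: ereal_ge_1_cases)
  case infty
  have "\<bar>u i + v i\<bar> \<le> lpnorm n \<infinity> u + lpnorm n \<infinity> v" if "i \<in> {1..n}" for i
    using abs_le_lpnorm[of \<infinity> i n u] abs_le_lpnorm[of \<infinity> i n v] that by (simp add: infty)
  then show ?thesis using assms infty by (auto simp: lpnorm_infty[of n "\<lambda>i. u i + v i"] intro!: Max.boundedI)
next
  case (real r)
  define A B where "A = lpnorm n pp u" and "B = lpnorm n pp v"
  have u: "\<bar>u i\<bar> \<le> A" and v: "\<bar>v i\<bar> \<le> B" if "i \<in> {1..n}" for i
    using abs_le_lpnorm[OF assms(1) that] by (auto simp: A_def B_def)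
  have nn: "A \<ge> 0" "B \<ge> 0" using assms by (auto simp: A_def B_def intro!: lpnorm_nonneg)
  \<comment> \<open>The scaling divides by \<open>A\<close> and \<open>B\<close>. A vector of norm 0
    vanishes on {1..n}, so dropping it leaves the norm of the sum unchanged.\<close>
  consider "A = 0" | "B = 0" | "A > 0" "B > 0" using nn by linarith
  then show ?thesis
  proof cases
    case 1
    then have "lpnorm n pp (\<lambda>i. u i + v i) = lpnorm n pp v"
      using u by (intro lpnorm_cong) force
    then show ?thesis using nn A_def by simp
  next
    case 2
    then have "lpnorm n pp (\<lambda>i. u i + v i) = lpnorm n pp u"
      using v by (intro lpnorm_cong) force
    then show ?thesis using nn B_def by simp
  next
    case 3
    define l where "l = A / (A + B)"
    have l: "0 < l" "l < 1" "1 - l = B / (A + B)" using 3 by (auto simp: l_def field_simps)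
    have Ar: "(\<Sum>i=1..n. \<bar>u i\<bar> powr r) = A powr r" and Br: "(\<Sum>i=1..n. \<bar>v i\<bar> powr r) = B powr r"
      using real by (simp_all add: A_def B_def lpnorm_ereal_powr)
    have "\<bar>u i + v i\<bar> powr r \<le>
        (A + B) powr r * (l * (\<bar>u i\<bar> powr r / A powr r) + (1 - l) * (\<bar>v i\<bar> powr r / B powr r))" for i
    proof -
      have "\<bar>u i + v i\<bar> powr r \<le> (\<bar>u i\<bar> + \<bar>v i\<bar>) powr r"
        using real by (intro powr_mono2) auto
      also have "\<bar>u i\<bar> + \<bar>v i\<bar> = (A + B) * (l * (\<bar>u i\<bar> / A) + (1 - l) * (\<bar>v i\<bar> / B))"
      proof -
        have "(A + B) * l = A" "(A + B) * (1 - l) = B" unfolding l(3) unfolding l_def using 3 by auto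
        then show ?thesis using 3 by (simp add: distrib_left flip: mult.assoc)
      qed
      also have "\<dots> powr r = (A + B) powr r * (l * (\<bar>u i\<bar> / A) + (1 - l) * (\<bar>v i\<bar> / B)) powr r"
        by (rule powr_mult)
      also have "\<dots> \<le> (A + B) powr r * (l * (\<bar>u i\<bar> / A) powr r + (1 - l) * (\<bar>v i\<bar> / B) powr r)"
        using 3 l real by (intro mult_left_mono powr_convex_combination) auto
      finally show ?thesis using 3 by (simp add: powr_divide)
    qed
    then have "(\<Sum>i=1..n. \<bar>u i + v i\<bar> powr r) \<le> (\<Sum>i=1..n.
        (A + B) powr r * (l * (\<bar>u i\<bar> powr r / A powr r) + (1 - l) * (\<bar>v i\<bar> powr r / B powr r)))"
      by (intro sum_mono) auto
    also have "\<dots> = (A + B) powr r * (l * ((\<Sum>i=1..n. \<bar>u i\<bar> powr r) / A powr r)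
        + (1 - l) * ((\<Sum>i=1..n. \<bar>v i\<bar> powr r) / B powr r))"
      by (simp only: distrib_left sum_distrib_left sum.distrib sum_divide_distrib)
    also have "\<dots> = (A + B) powr r" unfolding Ar Br using 3 by simp
    finally have "(\<Sum>i=1..n. \<bar>u i + v i\<bar> powr r) powr (1/r) \<le> ((A + B) powr r) powr (1/r)"
      using real by (intro powr_mono2) (auto intro: sum_nonneg)
    then show ?thesis
      using real 3 by (simp add: powr_powr lpnorm_ereal A_def B_def)
  qed
qed

lemma conj_exp_ge_1: "pp \<ge> 1 \<Longrightarrow> conj_exp pp \<ge> 1"
  by (cases rule: ereal_ge_1_cases[of pp]) (auto simp: conj_exp_def one_ereal_def field_simps)

text \<open>For finite exponents above 1, Young's inequality for the normalised entries |u i| / A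
  and |v i| / B is summed over i; the total is 1/s + 1/r = 1. At exponents 1 and infinity one factor
  is bounded by its maximum.\<close>

lemma lpnorm_Holder:
  assumes "pp \<ge> 1"
  shows "(\<Sum>i=1..n. u i * v i) \<le> lpnorm n (conj_exp pp) u * lpnorm n pp v"
proof -
  have le: "(\<Sum>i=1..n. u i * v i) \<le> (\<Sum>i=1..n. \<bar>u i\<bar> * \<bar>v i\<bar>)"
    by (intro sum_mono) (metis abs_ge_self abs_mult)
  consider "pp = 1" | "pp = \<infinity>" | r where "pp = ereal r" "r > 1"
    using assms by (cases pp) (auto simp: one_ereal_def le_less)
  then show ?thesis
  proof cases
    case 1
    have "(\<Sum>i=1..n. \<bar>u i\<bar> * \<bar>v i\<bar>) \<le> (\<Sum>i=1..n. lpnorm n \<infinity> u * \<bar>v i\<bar>)"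
      by (intro sum_mono mult_right_mono abs_le_lpnorm) auto
    with 1 le show ?thesis by (simp add: conj_exp_def lpnorm_one sum_distrib_left)
  next
    case 2
    have "(\<Sum>i=1..n. \<bar>u i\<bar> * \<bar>v i\<bar>) \<le> (\<Sum>i=1..n. \<bar>u i\<bar> * lpnorm n \<infinity> v)"
      by (intro sum_mono mult_left_mono abs_le_lpnorm) auto
    with 2 le show ?thesis by (simp add: conj_exp_def lpnorm_one sum_distrib_right)
  next
    case (3 r)
    define s where "s = r / (r - 1)"
    have s: "s > 1" "1/s + 1/r = 1" using 3 by (auto simp: s_def field_simps)
    have ce: "conj_exp pp = ereal s" using 3 by (simp add: conj_exp_def s_def one_ereal_def)
    define A B where "A = lpnorm n (ereal s) u" and "B = lpnorm n pp v"
    have u: "\<bar>u i\<bar> \<le> A" and v: "\<bar>v i\<bar> \<le> B" if "i \<in> {1..n}" for i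
      using abs_le_lpnorm[of "ereal s" i n u] abs_le_lpnorm[OF assms that, of v] s that
      by (auto simp: A_def B_def)
    have nn: "A \<ge> 0" "B \<ge> 0" by (auto simp: A_def B_def lpnorm_ereal 3)
    show ?thesis
    proof (cases "A > 0 \<and> B > 0")
      case False
      then have "(\<Sum>i=1..n. u i * v i) = 0"
        using u v nn by (intro sum.neutral) force
      then show ?thesis using nn by (simp add: ce A_def B_def)
    next
      case True
      have "(\<Sum>i=1..n. (\<bar>u i\<bar> / A) * (\<bar>v i\<bar> / B)) \<le>
          (\<Sum>i=1..n. (\<bar>u i\<bar> / A) powr s / s + (\<bar>v i\<bar> / B) powr r / r)"
        using True s 3 by (intro sum_mono Youngs_inequality) auto
      also have "\<dots> = (\<Sum>i=1..n. \<bar>u i\<bar> powr s) / A powr s / s + (\<Sum>i=1..n. \<bar>v i\<bar> powr r) / B powr r / r"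
        using True by (simp add: sum.distrib sum_divide_distrib powr_divide)
      also have "\<dots> = 1"
      proof -
        have "(\<Sum>i=1..n. \<bar>u i\<bar> powr s) = A powr s" "(\<Sum>i=1..n. \<bar>v i\<bar> powr r) = B powr r"
          using s 3 by (simp_all add: A_def B_def lpnorm_ereal_powr)
        moreover have "A powr s \<noteq> 0" "B powr r \<noteq> 0" using True by auto
        ultimately show ?thesis using s(2) by simp
      qed
      finally have "(\<Sum>i=1..n. \<bar>u i\<bar> * \<bar>v i\<bar>) / (A * B) \<le> 1"
        by (simp add: sum_divide_distrib)
      then have "(\<Sum>i=1..n. \<bar>u i\<bar> * \<bar>v i\<bar>) \<le> A * B" using True by (simp add: field_simps)
      with le show ?thesis by (simp add: ce A_def B_def)
    qed
  qed
qed

section \<open>Empirical averages and concentration\<close>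

lemma set_sample_pmf:
  assumes "x \<in> set_pmf (sample_pmf N f)" "k < N"
  shows "x k \<in> set_pmf f"
  using assms by (auto simp: sample_pmf_def set_Pi_pmf PiE_dflt_def)

lemma sample_pmf_range:
  assumes "x \<in> set_pmf (sample_pmf N f)" "set_pmf f \<subseteq> S"
  shows "x ` {..<N} \<subseteq> S"
  using set_sample_pmf[OF assms(1)] assms(2) by auto

text \<open>Swapping two sums, since each observation contributes \<open>g\<close> at exactly one
  point. A linear functional of the empirical distribution becomes an average over observations, the
  form to which Hoeffding's inequality applies.\<close>

lemma sum_emp:
  assumes "x ` {..<N} \<subseteq> {1..n}"
  shows "(\<Sum>i=1..n. g i * emp N x i) = (\<Sum>k<N. g (x k)) / N"
proof -
  have c: "real (card {k\<in>{..<N}. x k = i}) = (\<Sum>k<N. if x k = i then 1 else 0)" for i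
    by (simp flip: sum.inter_filter)
  have "(\<Sum>i=1..n. g i * emp N x i) = (\<Sum>i=1..n. \<Sum>k<N. if x k = i then g i else 0) / N"
    unfolding emp_def c sum_divide_distrib sum_distrib_left by (intro sum.cong) auto
  also have "(\<Sum>i=1..n. \<Sum>k<N. if x k = i then g i else 0) = (\<Sum>k<N. \<Sum>i=1..n. if x k = i then g i else 0)"
    by (rule sum.swap)
  also have "\<dots> = (\<Sum>k<N. g (x k))"
    using assms by (intro sum.cong) (auto simp: image_subset_iff)
  finally show ?thesis .
qed

text \<open>The averaged terms lie in [-1, 1], an interval of length 2, so Hoeffding's exponent is
  -2 N \<epsilon>^2 / 2^2.\<close>

lemma prob_sample_pmf_Hoeffding:
  fixes g :: "nat \<Rightarrow> real"
  assumes "N > 0" "set_pmf f \<subseteq> {1..n}" "\<And>i. i \<in> {1..n} \<Longrightarrow> \<bar>g i\<bar> \<le> 1" "\<epsilon> \<ge> 0"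
  shows "measure_pmf.prob (sample_pmf N f) {x. (\<Sum>i=1..n. g i * (emp N x i - pmf f i)) \<ge> \<epsilon>}
           \<le> exp (- real N * \<epsilon>\<^sup>2 / 2)"
proof -
  define M where "M = sample_pmf N f"
  have comp: "map_pmf (\<lambda>x. x k) M = f" if "k < N" for k
    using that by (simp add: M_def sample_pmf_def Pi_pmf_component)
  have distr: "distr M borel (\<lambda>x. g (x k)) = distr f borel g" if "k < N" for k
    by (subst comp[OF that, symmetric]) (simp add: map_pmf_rep_eq distr_distr o_def)
  have E: "measure_pmf.expectation M (\<lambda>x. g (x 0)) = (\<Sum>i=1..n. g i * pmf f i)"
  proof -
    have "measure_pmf.expectation M (\<lambda>x. g (x 0)) = measure_pmf.expectation (map_pmf (\<lambda>x. x 0) M) g"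
      by simp
    also have "\<dots> = (\<Sum>i=1..n. g i * pmf f i)"
      using assms comp by (simp add: integral_measure_pmf_real[of "{1..n}"] subset_iff)
    finally show ?thesis .
  qed
  interpret Hoeffding_ineq_iid M "{..<N}" "\<lambda>k x. g (x k)" "\<lambda>x. g (x 0)" "-1" 1 "\<Sum>i=1..n. g i * pmf f i"
  proof unfold_locales
    show "prob_space.indep_vars M (\<lambda>_. borel) (\<lambda>k x. g (x k)) {..<N}"
      unfolding M_def sample_pmf_def
      by (intro prob_space.indep_vars_compose2[OF _ indep_vars_Pi_pmf])
         (auto simp: measure_pmf.prob_space_axioms)
    show "AE x in M. g (x 0) \<in> {-1..1}"
    proof (rule AE_pmfI)
      fix x assume "x \<in> set_pmf M"
      then have "x 0 \<in> {1..n}" using set_sample_pmf[of x N f 0] assms by (auto simp: M_def)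
      from assms(3)[OF this] show "g (x 0) \<in> {-1..1}" by auto
    qed
  qed (use assms in \<open>auto simp: distr E\<close>)
  have "measure_pmf.prob M {x. (\<Sum>i=1..n. g i * (emp N x i - pmf f i)) \<ge> \<epsilon>}
      \<le> measure_pmf.prob M {x\<in>space M. (\<Sum>k<N. g (x k)) / card {..<N} \<ge> (\<Sum>i=1..n. g i * pmf f i) + \<epsilon>}"
  proof (rule measure_pmf.finite_measure_mono_AE)
    show "AE x in M. x \<in> {x. (\<Sum>i=1..n. g i * (emp N x i - pmf f i)) \<ge> \<epsilon>} \<longrightarrow>
       x \<in> {x\<in>space M. (\<Sum>k<N. g (x k)) / card {..<N} \<ge> (\<Sum>i=1..n. g i * pmf f i) + \<epsilon>}"
      using sum_emp[OF sample_pmf_range[OF _ assms(2)]]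
      by (intro AE_pmfI) (auto simp: M_def right_diff_distrib sum_subtractf)
  qed auto
  also have "\<dots> \<le> exp (-2 * real (card {..<N}) * \<epsilon>\<^sup>2 / (1 - (-1))\<^sup>2)"
    using assms by (intro Hoeffding_ineq_ge') auto
  finally show ?thesis by (simp add: M_def)
qed

section \<open>Independence of training and test samples\<close>

lemma pair_pmf_interchange:
  "pair_pmf (pair_pmf A B) (pair_pmf C D) =
     map_pmf (\<lambda>((a, c), (b, d)). ((a, b), (c, d))) (pair_pmf (pair_pmf A C) (pair_pmf B D))"
proof -
  have inj: "inj (\<lambda>((a, c), (b, d)). ((a, b), (c, d)))"
    by (auto simp: inj_def)
  show ?thesis
  proof (rule pmf_eqI)
    fix z :: "('a \<times> 'b) \<times> 'c \<times> 'd"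
    obtain a b c d where z: "z = ((a, b), (c, d))" by (metis surj_pair)
    show "pmf (pair_pmf (pair_pmf A B) (pair_pmf C D)) z =
        pmf (map_pmf (\<lambda>((a, c), (b, d)). ((a, b), (c, d))) (pair_pmf (pair_pmf A C) (pair_pmf B D))) z"
      using pmf_map_inj'[OF inj, of "pair_pmf (pair_pmf A C) (pair_pmf B D)" "((a, c), (b, d))"]
      by (simp add: z pmf_pair)
  qed
qed

text \<open>The conditional bound is integrated over the first component. This allows the training
  data, and with them the dual vector, to be held fixed.\<close>

lemma prob_pair_pmf_le:
  assumes "\<And>a. a \<in> set_pmf A \<Longrightarrow> measure_pmf.prob B {b. (a, b) \<in> S} \<le> c" "c \<ge> 0"
  shows "measure_pmf.prob (pair_pmf A B) S \<le> c"
proof -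
  have "emeasure (pair_pmf A B) S = (\<integral>\<^sup>+z. indicator S z \<partial>pair_pmf A B)"
    by simp
  also have "\<dots> = (\<integral>\<^sup>+a. \<integral>\<^sup>+b. indicator {b. (a, b) \<in> S} b \<partial>B \<partial>A)"
    unfolding nn_integral_pair_pmf' by (intro nn_integral_cong) (auto simp: indicator_def)
  also have "\<dots> = (\<integral>\<^sup>+a. emeasure B {b. (a, b) \<in> S} \<partial>A)"
    by simp
  also have "\<dots> \<le> (\<integral>\<^sup>+a. ennreal c \<partial>A)"
    using assms by (intro nn_integral_mono_AE AE_pmfI)
      (auto simp: measure_pmf.emeasure_eq_measure intro!: ennreal_leI)
  also have "\<dots> = ennreal c"
    by (simp add: measure_pmf.emeasure_space_1)
  finally show ?thesis using assms(2) by (simp add: measure_pmf.emeasure_eq_measure)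
qed

text \<open>The index set splits into {..<N} and {N..<2*N}, on which the sample is independent;
  shifting the second block by \<open>N\<close> turns it into a sample of its own.\<close>

lemma map_train_test_sample_pmf:
  "map_pmf (\<lambda>X. (train N X, test N X)) (sample_pmf (2 * N) f) = pair_pmf (sample_pmf N f) (sample_pmf N f)"
proof -
  define B where "B = {N..<2*N}"
  have shift: "map_pmf (\<lambda>g. g \<circ> (\<lambda>k. N + k)) (Pi_pmf B 0 (\<lambda>_. f)) = Pi_pmf {..<N} 0 (\<lambda>_. f)"
    by (rule Pi_pmf_bij_betw[symmetric])
       (auto simp: B_def lessThan_atLeast0 mult_2 intro!: bij_betw_byWitness[where f' = "\<lambda>k. k - N"])
  have "sample_pmf (2 * N) f = Pi_pmf ({..<N} \<union> B) 0 (\<lambda>_. f)"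
    unfolding sample_pmf_def B_def by (rule arg_cong[of _ _ "\<lambda>A. Pi_pmf A _ _"]) auto
  also have "\<dots> = map_pmf (\<lambda>(f, g) x. if x \<in> {..<N} then f x else g x)
       (pair_pmf (Pi_pmf {..<N} 0 (\<lambda>_. f)) (Pi_pmf B 0 (\<lambda>_. f)))"
    by (rule Pi_pmf_union) (auto simp: B_def)
  finally have "map_pmf (\<lambda>X. (train N X, test N X)) (sample_pmf (2 * N) f) =
     map_pmf (\<lambda>(x, y). (train N x, test N y)) (pair_pmf (sample_pmf N f) (Pi_pmf B 0 (\<lambda>_. f)))"
    unfolding sample_pmf_def
    by (simp add: pmf.map_comp o_def split_beta' train_def test_def cong: if_cong)
  also have "\<dots> = map_pmf (\<lambda>(x, y). (id x, (\<lambda>g. g \<circ> (\<lambda>k. N + k)) y)) (pair_pmf (sample_pmf N f) (Pi_pmf B 0 (\<lambda>_. f)))"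
  proof (intro map_pmf_cong refl)
    fix z assume "z \<in> set_pmf (pair_pmf (sample_pmf N f) (Pi_pmf B 0 (\<lambda>_. f)))"
    \<comment> \<open>Outside its block each factor takes the default value 0, which
      \<open>train\<close> and \<open>test\<close> also use; hence \<open>train N\<close> acts as
      the identity and \<open>test N\<close> as the plain shift.\<close>
    then have "\<forall>k. k \<ge> N \<longrightarrow> fst z k = 0" "\<forall>k. k \<notin> B \<longrightarrow> snd z k = 0"
      by (auto simp: sample_pmf_def B_def set_Pi_pmf PiE_dflt_def)
    then show "(case z of (x, y) \<Rightarrow> (train N x, test N y)) = (case z of (x, y) \<Rightarrow> (id x, (\<lambda>g. g \<circ> (\<lambda>k. N + k)) y))"
      by (auto simp: train_def test_def B_def split_beta fun_eq_iff)
  qed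
  also have "\<dots> = pair_pmf (sample_pmf N f) (sample_pmf N f)"
    unfolding map_pair shift by (simp add: sample_pmf_def)
  finally show ?thesis .
qed

lemma map_train_test_pair_pmf:
  "map_pmf (\<lambda>(X, Y). ((train N X, train N Y), (test N X, test N Y)))
     (pair_pmf (sample_pmf (2 * N) p) (sample_pmf (2 * N) q)) =
   pair_pmf (pair_pmf (sample_pmf N p) (sample_pmf N q)) (pair_pmf (sample_pmf N p) (sample_pmf N q))"
proof -
  have "pair_pmf (pair_pmf (sample_pmf N p) (sample_pmf N q)) (pair_pmf (sample_pmf N p) (sample_pmf N q)) =
     map_pmf (\<lambda>((a, c), (b, d)). ((a, b), (c, d)))
       (pair_pmf (pair_pmf (sample_pmf N p) (sample_pmf N p)) (pair_pmf (sample_pmf N q) (sample_pmf N q)))"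
    by (rule pair_pmf_interchange)
  also have "\<dots> = map_pmf (\<lambda>((a, c), (b, d)). ((a, b), (c, d)))
     (map_pmf (\<lambda>(X, Y). ((train N X, test N X), (train N Y, test N Y)))
        (pair_pmf (sample_pmf (2 * N) p) (sample_pmf (2 * N) q)))"
    by (simp only: map_train_test_sample_pmf[symmetric] map_pair)
  finally show ?thesis by (simp add: pmf.map_comp o_def split_beta')
qed

section \<open>The threshold\<close>

lemma tauN_root:
  assumes "N > 0" "0 < \<alpha>" "\<alpha> < 1"
  shows "tauN N \<alpha> > 0" "(tauN N \<alpha>)\<^sup>2 / (1 + 2/3 * tauN N \<alpha>) = 2 / real N * ln (2 / \<alpha>)"
proof -
  define c where "c = 2 / real N * ln (2 / \<alpha>)"
  have c: "c > 0" using assms by (auto simp: c_def)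
  have eq: "t\<^sup>2 / (1 + 2/3 * t) = c \<longleftrightarrow> t\<^sup>2 = c * (1 + 2/3 * t)" if "t > 0" for t
    using that by (simp add: divide_eq_eq)
  \<comment> \<open>Clearing the denominator gives t^2 - (2/3) c t - c = 0, and this is its positive
    root.\<close>
  define t0 where "t0 = c/3 + sqrt (c\<^sup>2/9 + c)"
  have sq: "sqrt (c\<^sup>2/9 + c) ^ 2 = c\<^sup>2/9 + c" using c by simp
  have t0: "t0 > 0" using c by (auto simp: t0_def intro!: add_pos_nonneg)
  have "t0\<^sup>2 = c * (1 + 2/3 * t0)"
    using sq unfolding t0_def power2_sum by (simp add: power2_eq_square algebra_simps)
  moreover have "t = t0" if t: "t > 0" "t\<^sup>2 = c * (1 + 2/3 * t)" for t
  proof (rule ccontr)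
    assume "t \<noteq> t0"
    \<comment> \<open>The product of two distinct roots is -c, so they cannot both be positive.
      Uniqueness justifies the definite description in \<open>tauN\<close>.\<close>
    have "(t - t0) * (t + t0 - 2/3 * c) = 0"
      using t \<open>t0\<^sup>2 = _\<close> by (simp add: power2_eq_square field_simps)
    then have "t0 = 2/3 * c - t" using \<open>t \<noteq> t0\<close> by simp
    then have "t * t0 = t * (2/3 * c - t)" by (rule arg_cong)
    also have "\<dots> = 2/3 * c * t - t\<^sup>2" by (simp add: power2_eq_square algebra_simps)
    finally have "t * t0 = 2/3 * c * t - t\<^sup>2" .
    then have "t * t0 = - c" unfolding t(2) by (simp add: algebra_simps)
    then show False using t t0 c mult_pos_pos[of t t0] by linarith
  qed
  ultimately have "\<exists>!t. t > 0 \<and> t\<^sup>2 / (1 + 2/3 * t) = c" using t0 eq by blast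
  from theI'[OF this] show "tauN N \<alpha> > 0" "(tauN N \<alpha>)\<^sup>2 / (1 + 2/3 * tauN N \<alpha>) = 2 / real N * ln (2 / \<alpha>)"
    unfolding tauN_def c_def by auto
qed

lemma exp_tauN_le:
  assumes "N > 0" "0 < \<alpha>" "\<alpha> < 1"
  shows "exp (- real N * (tauN N \<alpha>)\<^sup>2 / 2) \<le> \<alpha> / 2"
proof -
  define t where "t = tauN N \<alpha>"
  have t: "t > 0" "t\<^sup>2 / (1 + 2/3 * t) = 2 / real N * ln (2 / \<alpha>)"
    using tauN_root[OF assms] by (auto simp: t_def)
  have "2 / real N * ln (2 / \<alpha>) \<le> t\<^sup>2"
    unfolding t(2)[symmetric] using t(1) by (intro divide_le_eq[THEN iffD2]) (auto simp: algebra_simps)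
  then have "ln (2 / \<alpha>) \<le> real N * t\<^sup>2 / 2" using assms by (simp add: field_simps)
  then have "exp (- (real N * t\<^sup>2 / 2)) \<le> exp (- ln (2 / \<alpha>))" by simp
  also have "\<dots> = \<alpha> / 2" using assms by (simp add: exp_minus)
  finally show ?thesis by (simp add: t_def)
qed

section \<open>Non-strict deviations of linear functionals\<close>

lemma prob_pmf_ge_scaled:
  assumes "c \<ge> 0" "\<And>x. c * pmf P x \<le> pmf Q x"
  shows "c * measure_pmf.prob P A \<le> measure_pmf.prob Q A"
proof -
  have "ennreal c * emeasure P A = (\<integral>\<^sup>+x. ennreal c * pmf P x \<partial>count_space A)"
    by (simp add: nn_integral_cmult nn_integral_pmf)
  also have "\<dots> \<le> (\<integral>\<^sup>+x. pmf Q x \<partial>count_space A)"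
    using assms by (intro nn_integral_mono) (simp flip: ennreal_mult)
  also have "\<dots> = emeasure Q A" by (simp add: nn_integral_pmf)
  finally show ?thesis
    using assms(1) by (simp add: measure_pmf.emeasure_eq_measure flip: ennreal_mult)
qed

text \<open>The law of a sample is a product of \<open>N\<close> factors, each losing at most the
  factor \<open>c\<close>.\<close>

lemma prob_sample_pmf_ge_scaled:
  assumes "c \<ge> 0" "\<And>i. c * pmf p i \<le> pmf f i"
  shows "c ^ N * measure_pmf.prob (sample_pmf N p) A \<le> measure_pmf.prob (sample_pmf N f) A"
proof (rule prob_pmf_ge_scaled)
  fix x
  have "c ^ N * (\<Prod>k<N. pmf p (x k)) = (\<Prod>k<N. c * pmf p (x k))"
    by (simp add: prod.distrib)
  also have "\<dots> \<le> (\<Prod>k<N. pmf f (x k))"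
    using assms by (intro prod_mono) auto
  finally show "c ^ N * pmf (sample_pmf N p) x \<le> pmf (sample_pmf N f) x"
    unfolding sample_pmf_def pmf_Pi[OF finite_lessThan] by (auto split: if_split)
qed (use assms in auto)

definition mix_pmf :: "real \<Rightarrow> 'a pmf \<Rightarrow> 'a pmf \<Rightarrow> 'a pmf" where
  "mix_pmf \<epsilon> P Q = bind_pmf (bernoulli_pmf \<epsilon>) (\<lambda>b. if b then P else Q)"

lemma pmf_mix_pmf:
  assumes "0 \<le> \<epsilon>" "\<epsilon> \<le> 1"
  shows "pmf (mix_pmf \<epsilon> P Q) i = \<epsilon> * pmf P i + (1 - \<epsilon>) * pmf Q i"
  using assms by (simp add: mix_pmf_def pmf_bind)

lemma set_mix_pmf_subset: "set_pmf (mix_pmf \<epsilon> P Q) \<subseteq> set_pmf P \<union> set_pmf Q"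
  by (auto simp: mix_pmf_def split: if_splits)

text \<open>The hypothesis on \<open>\<rho>\<close> at one level \<open>\<beta>\<close>. The
  quantifier over \<open>f\<close> matters: besides \<open>p\<close> and \<open>q\<close>,
  perturbations of them and a special two-point distribution are substituted.\<close>

definition deviation_bound :: "nat \<Rightarrow> nat \<Rightarrow> ereal \<Rightarrow> real \<Rightarrow> real \<Rightarrow> bool" where
  "deviation_bound n N pp \<beta> r \<longleftrightarrow>
     (\<forall>f :: nat pmf. set_pmf f \<subseteq> {1..n} \<longrightarrow>
        measure_pmf.prob (sample_pmf N f) {x. lpnorm n pp (\<lambda>i. emp N x i - pmf f i) > r} \<le> \<beta>)"

text \<open>Some distribution differs from every possible empirical distribution, so a bound
  \<open>r \<le> 0\<close> would be exceeded with probability 1. Two points are needed: on a single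
  point every deviation is 0.\<close>

lemma deviation_bound_pos:
  assumes "N > 0" "pp \<ge> 1" "n \<ge> 2" "\<beta> < 1" "deviation_bound n N pp \<beta> r"
  shows "r > 0"
proof (rule ccontr)
  assume "\<not> r > 0"
  \<comment> \<open>No empirical distribution of \<open>N\<close> observations has an atom of mass \<open>1 / (2 N)\<close>.\<close>
  define f :: "nat pmf" where "f = mix_pmf (1 / (2 * real N)) (return_pmf 1) (return_pmf 2)"
  have f1: "pmf f 1 = 1 / (2 * real N)"
    using assms by (simp add: f_def pmf_mix_pmf)
  have "set_pmf f \<subseteq> {1} \<union> {2}"
    unfolding f_def using set_mix_pmf_subset[of _ "return_pmf 1" "return_pmf 2"] by fastforce
  also have "\<dots> \<subseteq> {1..n}" using assms by auto
  finally have f: "set_pmf f \<subseteq> {1..n}" .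
  have "lpnorm n pp (\<lambda>i. emp N x i - pmf f i) > r" for x
  proof -
    define m where "m = card {k\<in>{..<N}. x k = 1}"
    \<comment> \<open>An empirical mass m / N equal to 1 / (2 N) would mean 2 m = 1, which parity
      excludes.\<close>
    have "2 * m \<noteq> 1" by presburger
    then have "2 * real m \<noteq> 1" by (metis of_nat_1 of_nat_eq_iff of_nat_mult of_nat_numeral)
    then have "emp N x 1 \<noteq> pmf f 1"
      unfolding f1 using assms(1) by (simp only: emp_def m_def[symmetric]) (simp add: field_simps)
    then have "0 < \<bar>emp N x 1 - pmf f 1\<bar>" by simp
    also have "\<dots> \<le> lpnorm n pp (\<lambda>i. emp N x i - pmf f i)"
      using assms abs_le_lpnorm[of pp 1 n "\<lambda>i. emp N x i - pmf f i"] by simp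
    finally show ?thesis using \<open>\<not> r > 0\<close> by simp
  qed
  then have "measure_pmf.prob (sample_pmf N f) {x. lpnorm n pp (\<lambda>i. emp N x i - pmf f i) > r} = 1"
    by simp
  moreover have "measure_pmf.prob (sample_pmf N f) {x. lpnorm n pp (\<lambda>i. emp N x i - pmf f i) > r} \<le> \<beta>"
    using assms f by (auto simp: deviation_bound_def)
  ultimately show False using assms by simp
qed

lemma prob_linear_deviation_ge:
  assumes "N > 0" "pp \<ge> 1" "r > 0" "set_pmf p \<subseteq> {1..n}"
    and u: "lpnorm n (conj_exp pp) u = 1"
    and bound: "deviation_bound n N pp \<beta> r"
  shows "measure_pmf.prob (sample_pmf N p) {x. (\<Sum>i=1..n. u i * (emp N x i - pmf p i)) \<ge> r} \<le> \<beta>"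
    (is "measure_pmf.prob ?M ?A \<le> \<beta>")
proof -
  define L where "L = (\<lambda>f :: nat pmf. \<Sum>i=1..n. u i * pmf f i)"
  have n: "{1..n} \<noteq> {}" using assms(4) set_pmf_not_empty[of p] by auto
  \<comment> \<open>The point \<open>j\<close> receives the extra mass: as a minimiser of
    \<open>u\<close> it can only lower the mean \<open>L\<close>.\<close>
  define j where "j = arg_min_on u {1..n}"
  have j: "j \<in> {1..n}" "\<And>i. i \<in> {1..n} \<Longrightarrow> u j \<le> u i"
    using n by (auto simp: j_def intro: arg_min_if_finite arg_min_least simp del: atLeastAtMost_iff)
  have sum1: "(\<Sum>i=1..n. pmf p i) = 1" using assms(4) by (intro sum_pmf_eq_1) auto
  have Lp: "L p - u j = (\<Sum>i=1..n. pmf p i * (u i - u j))"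
    by (simp only: L_def right_diff_distrib sum_subtractf mult.commute[of "pmf p _"])
       (simp only: sum_distrib_left[symmetric] sum1 mult_1_right)
  have le: "measure_pmf.prob (sample_pmf N f) {x. lpnorm n pp (\<lambda>i. emp N x i - pmf f i) > r} \<le> \<beta>"
    if "set_pmf f \<subseteq> {1..n}" for f
    using bound that by (auto simp: deviation_bound_def)
  have "L p - u j \<ge> 0" unfolding Lp using j by (intro sum_nonneg) auto
  then consider "L p > u j" | "L p - u j = 0" by fastforce
  then show ?thesis
  proof cases
    case 1
    have "(1 - \<epsilon>) ^ N * measure_pmf.prob ?M ?A \<le> \<beta>" if \<epsilon>: "0 < \<epsilon>" "\<epsilon> < 1" for \<epsilon>
    proof -
      define f where "f = mix_pmf \<epsilon> (return_pmf j) p"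
      have pf: "pmf f i = \<epsilon> * (if i = j then 1 else 0) + (1 - \<epsilon>) * pmf p i" for i
        using \<epsilon> by (simp add: f_def pmf_mix_pmf)
      have f: "set_pmf f \<subseteq> {1..n}"
        unfolding f_def using set_mix_pmf_subset[of \<epsilon> "return_pmf j" p] j assms(4) by auto
      have "L f = \<epsilon> * (\<Sum>i=1..n. u i * (if i = j then 1 else 0)) + (1 - \<epsilon>) * L p"
        by (simp only: L_def pf distrib_left sum.distrib sum_distrib_left mult_ac)
      also have "(\<Sum>i=1..n. u i * (if i = j then 1 else 0)) = u j"
        using j(1) by (simp add: if_distrib cong: if_cong)
      \<comment> \<open>The mean drops by a strictly positive amount, so on the same sample a
        deviation of at least \<open>r\<close> from \<open>p\<close> becomes a deviation above
        \<open>r\<close> from \<open>f\<close>.\<close>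
      finally have Lf: "L f = L p - \<epsilon> * (L p - u j)" by (simp add: algebra_simps)
      have "(1 - \<epsilon>) ^ N * measure_pmf.prob ?M ?A \<le> measure_pmf.prob (sample_pmf N f) ?A"
        using \<epsilon> by (intro prob_sample_pmf_ge_scaled) (auto simp: pf)
      also have "\<dots> \<le> measure_pmf.prob (sample_pmf N f) {x. lpnorm n pp (\<lambda>i. emp N x i - pmf f i) > r}"
      proof (intro measure_pmf.finite_measure_mono, safe)
        fix x assume x: "r \<le> (\<Sum>i=1..n. u i * (emp N x i - pmf p i))"
        also have "\<dots> < (\<Sum>i=1..n. u i * (emp N x i - pmf p i)) + \<epsilon> * (L p - u j)"
          using 1 \<epsilon> by simp
        also have "\<dots> = (\<Sum>i=1..n. u i * (emp N x i - pmf f i))"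
          using Lf by (simp add: right_diff_distrib sum_subtractf L_def)
        also have "\<dots> \<le> lpnorm n pp (\<lambda>i. emp N x i - pmf f i)"
          using lpnorm_Holder[OF assms(2), of u "\<lambda>i. emp N x i - pmf f i" n] u by simp
        finally show "r < lpnorm n pp (\<lambda>i. emp N x i - pmf f i)" .
      qed auto
      also have "\<dots> \<le> \<beta>" using f by (rule le)
      finally show ?thesis .
    qed
    then have "\<forall>\<^sub>F \<epsilon> in at_right 0. (1 - \<epsilon>) ^ N * measure_pmf.prob ?M ?A \<le> \<beta>"
      unfolding eventually_at_right_field by (intro exI[of _ 1]) auto
    moreover have "((\<lambda>\<epsilon>. (1 - \<epsilon>) ^ N * measure_pmf.prob ?M ?A) \<longlongrightarrow> (1 - 0) ^ N * measure_pmf.prob ?M ?A) (at_right 0)"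
      by (intro tendsto_intros)
    ultimately show ?thesis
      using tendsto_upperbound[of _ _ "at_right (0::real)" \<beta>] by force
  next
    case 2
    \<comment> \<open>Nonnegative terms with sum 0 all vanish: \<open>u\<close> is constant on the
      support of \<open>p\<close>, so the functional does not fluctuate at all.\<close>
    then have "\<forall>i\<in>{1..n}. pmf p i * (u i - u j) = 0"
      unfolding Lp using j by (subst (asm) sum_nonneg_eq_0_iff) auto
    then have up: "u i = u j" if "i \<in> set_pmf p" for i
      using that assms(4) by (auto simp: set_pmf_iff)
    have "x \<notin> ?A" if x: "x \<in> set_pmf ?M" for x
    proof -
      have "(\<Sum>k<N. u (x k)) = (\<Sum>k<N. u j)"
        using set_sample_pmf[OF x] up by (intro sum.cong) auto
      then have "(\<Sum>i=1..n. u i * emp N x i) = u j"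
        unfolding sum_emp[OF sample_pmf_range[OF x assms(4)]] using assms(1) by simp
      then have "(\<Sum>i=1..n. u i * (emp N x i - pmf p i)) = 0"
        using 2 by (simp add: right_diff_distrib sum_subtractf L_def)
      then show ?thesis using assms(3) by simp
    qed
    then have "measure_pmf.prob ?M ?A = 0" by (auto simp: measure_pmf_zero_iff)
    moreover have "0 \<le> \<beta>" by (rule order_trans[OF measure_nonneg le[OF assms(4)]])
    ultimately show ?thesis by simp
  qed
qed

section \<open>The test for a fixed dual vector\<close>

definition test_stat :: "nat \<Rightarrow> nat \<Rightarrow> (nat \<Rightarrow> real) \<Rightarrow> (nat \<Rightarrow> nat) \<Rightarrow> (nat \<Rightarrow> nat) \<Rightarrow> real" where
  "test_stat n N u x y = (\<Sum>i=1..n. u i / lpnorm n \<infinity> u * (emp N x i - emp N y i))"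

text \<open>Exposes the dual vector as an argument, so that it can be frozen once the training
  samples are given.\<close>

lemma chi_eq_test_stat:
  "chi n N e X Y = test_stat n N (e (train N X) (train N Y)) (test N X) (test N Y)"
  by (simp add: chi_def test_stat_def Let_def)

text \<open>If \<open>u\<close> vanishes on {1..n}, division by zero gives 0 and the bound
  survives.\<close>

lemma abs_normalized_le_1:
  assumes "i \<in> {1..n}"
  shows "\<bar>u i / lpnorm n \<infinity> u\<bar> \<le> 1"
  using abs_le_lpnorm[of \<infinity> i n u] assms by (auto simp: abs_divide divide_le_eq_1)

lemma test_stat_le_2:
  assumes "N > 0" "x ` {..<N} \<subseteq> {1..n}" "y ` {..<N} \<subseteq> {1..n}"
  shows "test_stat n N u x y \<le> 2"
proof -
  define h where "h = (\<lambda>i. u i / lpnorm n \<infinity> u)"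
  have avg: "\<bar>(\<Sum>k<N. h (z k)) / N\<bar> \<le> 1" if "z ` {..<N} \<subseteq> {1..n}" for z
  proof -
    have "\<bar>\<Sum>k<N. h (z k)\<bar> \<le> (\<Sum>k<N. 1)"
      using that abs_normalized_le_1[of _ n u] unfolding h_def
      by (intro order_trans[OF sum_abs] sum_mono) auto
    then show ?thesis using assms(1) by (simp add: abs_divide)
  qed
  have "test_stat n N u x y = (\<Sum>k<N. h (x k)) / N - (\<Sum>k<N. h (y k)) / N"
    using sum_emp[OF assms(2), of h] sum_emp[OF assms(3), of h]
    by (simp add: test_stat_def h_def right_diff_distrib sum_subtractf)
  then show ?thesis using avg[OF assms(2)] avg[OF assms(3)] by linarith
qed

lemma prob_test_stat_gt:
  assumes "N > 0" "0 < \<alpha>" "\<alpha> < 1" "set_pmf p \<subseteq> {1..n}"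
  shows "measure_pmf.prob (pair_pmf (sample_pmf N p) (sample_pmf N p))
           {(x, y). test_stat n N u x y > 2 * tauN' N \<alpha>} \<le> \<alpha>"
    (is "measure_pmf.prob ?M ?S \<le> \<alpha>")
proof (cases "tauN N \<alpha> < 1")
  case False
  have "z \<notin> ?S" if "z \<in> set_pmf ?M" for z
  proof -
    have "test_stat n N u (fst z) (snd z) \<le> 2"
      using that assms by (intro test_stat_le_2 sample_pmf_range) auto
    then show ?thesis using False by (auto simp: tauN'_def)
  qed
  then have "measure_pmf.prob ?M ?S = 0" by (auto simp: measure_pmf_zero_iff)
  then show ?thesis using assms by simp
next
  case True
  define t where "t = tauN N \<alpha>"
  define h where "h = (\<lambda>i. u i / lpnorm n \<infinity> u)"
  have t: "t \<ge> 0" "tauN' N \<alpha> = t" using tauN_root(1)[OF assms(1-3)] True by (auto simp: t_def tauN'_def)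
  have h: "\<bar>h i\<bar> \<le> 1" if "i \<in> {1..n}" for i using abs_normalized_le_1[OF that] by (simp add: h_def)
  define D where "D = (\<lambda>x. \<Sum>i=1..n. h i * (emp N x i - pmf p i))"
  define D' where "D' = (\<lambda>x. \<Sum>i=1..n. - h i * (emp N x i - pmf p i))"
  have *: "measure_pmf.prob (sample_pmf N p) {x. D x \<ge> t} \<le> \<alpha> / 2"
    "measure_pmf.prob (sample_pmf N p) {x. D' x \<ge> t} \<le> \<alpha> / 2"
    unfolding D_def D'_def using h t(1) assms(1,4)
    by (intro order_trans[OF prob_sample_pmf_Hoeffding exp_tauN_le[OF assms(1-3), folded t_def]]; simp)+
  \<comment> \<open>Both test samples have the same law, so subtracting \<open>pmf p\<close> from
    each leaves the difference unchanged. A sum above \<open>2 * t\<close> forces one summand to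
    reach \<open>t\<close>.\<close>
  have "test_stat n N u x y = D x + D' y" for x y
    by (simp add: test_stat_def D_def D'_def h_def algebra_simps sum_subtractf sum_negf sum.distrib)
  then have "?S \<subseteq> (fst -` {x. D x \<ge> t}) \<union> (snd -` {x. D' x \<ge> t})"
    by (auto simp: t)
  then have "measure_pmf.prob ?M ?S \<le> measure_pmf.prob ?M ((fst -` {x. D x \<ge> t}) \<union> (snd -` {x. D' x \<ge> t}))"
    by (intro measure_pmf.finite_measure_mono) auto
  also have "\<dots> \<le> measure_pmf.prob ?M (fst -` {x. D x \<ge> t}) + measure_pmf.prob ?M (snd -` {x. D' x \<ge> t})"
    by (intro measure_subadditive) auto
  also have "\<dots> \<le> \<alpha> / 2 + \<alpha> / 2"
    unfolding measure_map_pmf[symmetric] map_fst_pair_pmf map_snd_pair_pmf using * by (rule add_mono)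
  finally show ?thesis by simp
qed

text \<open>The constant 6 is spent in three instalments of \<open>2 * r\<close>: replacing
  \<open>p\<close> and \<open>q\<close> by the training empirical distributions in the norm,
  returning from these to \<open>p\<close> and \<open>q\<close> inside the functional given by
  \<open>u\<close>, and passing to the test samples. The last instalment is strict, hence so is the
  conclusion.\<close>

lemma test_stat_gt:
  assumes "pp \<ge> 1" "n \<ge> 1" "t \<ge> 0"
    and u: "(\<Sum>i=1..n. u i * (emp N x i - emp N y i)) = lpnorm n pp (\<lambda>i. emp N x i - emp N y i)"
      "lpnorm n (conj_exp pp) u = 1"
    and train: "lpnorm n pp (\<lambda>i. emp N x i - pmf p i) \<le> r" "lpnorm n pp (\<lambda>i. emp N y i - pmf q i) \<le> r"
    and test: "(\<Sum>i=1..n. u i * (emp N x' i - pmf p i)) > - r"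
      "(\<Sum>i=1..n. u i * (emp N y' i - pmf q i)) < r"
    and sep: "lpnorm n pp (\<lambda>i. pmf p i - pmf q i) \<ge> 6 * r + 2 * t"
  shows "test_stat n N u x' y' > 2 * t"
proof -
  define W where "W = (\<lambda>v. \<Sum>i=1..n. u i * v i)"
  have W_diff: "W (\<lambda>i. v i - w i) = W v - W w" for v w
    by (simp add: W_def right_diff_distrib sum_subtractf)
  have Holder: "W v \<le> lpnorm n pp v" for v
    using lpnorm_Holder[OF assms(1), of u v n] u by (simp add: W_def)
  have "lpnorm n pp (\<lambda>i. pmf p i - pmf q i) =
      lpnorm n pp (\<lambda>i. (pmf p i - emp N x i) + ((emp N x i - emp N y i) + (emp N y i - pmf q i)))"
    by simp
  also have "\<dots> \<le> lpnorm n pp (\<lambda>i. pmf p i - emp N x i) +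
      (lpnorm n pp (\<lambda>i. emp N x i - emp N y i) + lpnorm n pp (\<lambda>i. emp N y i - pmf q i))"
    by (intro order_trans[OF lpnorm_triangle] add_left_mono lpnorm_triangle assms)
  also have "\<dots> \<le> 2 * r + (W (emp N x) - W (emp N y))"
    using train u(1) lpnorm_minus_commute[of n pp "pmf p" "emp N x"] W_diff[of "emp N x" "emp N y"]
    by (simp add: W_def)
  finally have "4 * r + 2 * t \<le> W (emp N x) - W (emp N y)" using sep by simp
  moreover have "W (emp N x) - W (pmf p) \<le> r" "W (pmf q) - W (emp N y) \<le> r"
    using Holder[of "\<lambda>i. emp N x i - pmf p i"] Holder[of "\<lambda>i. pmf q i - emp N y i"] train
      lpnorm_minus_commute[of n pp "pmf q" "emp N y"] by (simp_all add: W_diff)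
  moreover have "W (emp N x') - W (pmf p) > - r" "W (emp N y') - W (pmf q) < r"
    using test unfolding W_diff[symmetric] by (simp_all add: W_def)
  ultimately have gt: "W (emp N x') - W (emp N y') > 2 * t" by linarith
  define m where "m = lpnorm n \<infinity> u"
  have m_le: "m \<le> 1"
    unfolding m_def lpnorm_infty u(2)[symmetric] using assms(1,2)
    by (intro Max.boundedI) (auto intro!: abs_le_lpnorm conj_exp_ge_1)
  have "m \<noteq> 0"
  proof
    assume "m = 0"
    then have "u i = 0" if "i \<in> {1..n}" for i
      using abs_le_lpnorm[of \<infinity> i n u] that by (simp add: m_def)
    then have "W v = 0" for v by (simp add: W_def)
    then show False using gt assms(3) by simp
  qed
  then have m: "m > 0" using lpnorm_nonneg[of \<infinity> n u] assms(2) by (simp add: m_def)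
  have "test_stat n N u x' y' = (W (emp N x') - W (emp N y')) / m"
    by (simp add: test_stat_def W_def m_def sum_divide_distrib right_diff_distrib diff_divide_distrib sum_subtractf)
  \<comment> \<open>Normalising by \<open>m\<close> with \<open>0 < m\<close> and
    \<open>m \<le> 1\<close> can only enlarge a positive value.\<close>
  moreover have "\<dots> \<ge> W (emp N x') - W (emp N y')"
    using m m_le gt assms(3) by (simp add: le_divide_eq mult_left_le)
  ultimately show ?thesis using gt by linarith
qed

section \<open>The two error bounds\<close>

theorem theorem2:
  fixes n N :: nat and pp :: ereal and \<alpha> :: real and p q :: "nat pmf"
    and e :: "(nat \<Rightarrow> nat) \<Rightarrow> (nat \<Rightarrow> nat) \<Rightarrow> nat \<Rightarrow> real"
    and \<rho> :: "real \<Rightarrow> real"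
  assumes "N > 0" and "pp \<ge> 1" and "0 < \<alpha>" and "\<alpha> < 1"
    and "set_pmf p \<subseteq> {1..n}" and "set_pmf q \<subseteq> {1..n}"
    and e_choice: "\<And>x y. x ` {..<N} \<subseteq> {1..n} \<Longrightarrow> y ` {..<N} \<subseteq> {1..n} \<Longrightarrow>
          (\<Sum>i=1..n. e x y i * (emp N x i - emp N y i)) = lpnorm n pp (\<lambda>i. emp N x i - emp N y i)
          \<and> lpnorm n (conj_exp pp) (e x y) = 1"
  shows "(p = q \<longrightarrow>
            measure_pmf.prob (pair_pmf (sample_pmf (2*N) p) (sample_pmf (2*N) q))
              {(X, Y). claims_H1 n N e \<alpha> X Y} \<le> \<alpha>)
       \<and> (\<forall>\<beta>. 0 < \<beta> \<and> \<beta> < 1/4 \<longrightarrow>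
            (\<forall>f :: nat pmf. set_pmf f \<subseteq> {1..n} \<longrightarrow>
               measure_pmf.prob (sample_pmf N f)
                 {x. lpnorm n pp (\<lambda>i. emp N x i - pmf f i) > \<rho> \<beta>} \<le> \<beta>) \<longrightarrow>
            lpnorm n pp (\<lambda>i. pmf p i - pmf q i) \<ge> 6 * \<rho> \<beta> + 2 * tauN' N \<alpha> \<longrightarrow>
            measure_pmf.prob (pair_pmf (sample_pmf (2*N) p) (sample_pmf (2*N) q))
              {(X, Y). \<not> claims_H1 n N e \<alpha> X Y} \<le> 4 * \<beta>)"
proof -
  \<comment> \<open>Regroups the data by role, training pair first and test pair second; the two
    pairs are independent with the same law \<open>M\<close>.\<close>
  define T where "T = (\<lambda>(X, Y). ((train N X, train N Y), (test N X, test N Y)))"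
  define M where "M = pair_pmf (sample_pmf N p) (sample_pmf N q)"
  define claim where "claim = (\<lambda>((x, y), (x', y')). test_stat n N (e x y) x' y' > 2 * tauN' N \<alpha>)"
  have law: "map_pmf T (pair_pmf (sample_pmf (2*N) p) (sample_pmf (2*N) q)) = pair_pmf M M"
    unfolding T_def M_def by (rule map_train_test_pair_pmf)
  have claims: "claims_H1 n N e \<alpha> X Y \<longleftrightarrow> claim (T (X, Y))" for X Y
    by (simp add: claims_H1_def chi_eq_test_stat claim_def T_def)
  have prob_claim: "measure_pmf.prob (pair_pmf (sample_pmf (2*N) p) (sample_pmf (2*N) q))
        {(X, Y). claims_H1 n N e \<alpha> X Y} = measure_pmf.prob (pair_pmf M M) {z. claim z}"
    unfolding law[symmetric] measure_map_pmf claims by (rule arg_cong[where f = "measure_pmf.prob _"]) auto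
  have prob_not_claim: "measure_pmf.prob (pair_pmf (sample_pmf (2*N) p) (sample_pmf (2*N) q))
        {(X, Y). \<not> claims_H1 n N e \<alpha> X Y} = measure_pmf.prob (pair_pmf M M) {z. \<not> claim z}"
    unfolding law[symmetric] measure_map_pmf claims by (rule arg_cong[where f = "measure_pmf.prob _"]) auto
  have "measure_pmf.prob (pair_pmf M M) {z. claim z} \<le> \<alpha>" if "p = q"
  proof (rule prob_pair_pmf_le)
    fix a
    show "measure_pmf.prob M {b. (a, b) \<in> {z. claim z}} \<le> \<alpha>"
      using prob_test_stat_gt[OF assms(1,3,4,5), of "e (fst a) (snd a)"] that
      by (simp add: M_def claim_def split_beta')
  qed (use assms in auto)
  moreover have "measure_pmf.prob (pair_pmf M M) {z. \<not> claim z} \<le> 4 * \<beta>"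
    if \<beta>: "0 < \<beta>" "\<beta> < 1/4" and bound: "deviation_bound n N pp \<beta> (\<rho> \<beta>)"
      and sep: "lpnorm n pp (\<lambda>i. pmf p i - pmf q i) \<ge> 6 * \<rho> \<beta> + 2 * tauN' N \<alpha>" for \<beta>
  proof -
    define r where "r = \<rho> \<beta>"
    have n: "n \<ge> 1" using assms(5) set_pmf_not_empty[of p] by (cases n) auto
    have tau: "tauN' N \<alpha> > 0" using tauN_root(1)[OF assms(1,3,4)] by (simp add: tauN'_def)
    have le: "measure_pmf.prob (sample_pmf N f) {x. lpnorm n pp (\<lambda>i. emp N x i - pmf f i) > r} \<le> \<beta>"
      if "set_pmf f \<subseteq> {1..n}" for f
      using bound that by (auto simp: deviation_bound_def r_def)
    have "r \<ge> 0"
    proof (rule ccontr)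
      assume "\<not> r \<ge> 0"
      then have "lpnorm n pp (\<lambda>i. emp N x i - pmf p i) > r" for x
        using lpnorm_nonneg[OF assms(2) n, of "\<lambda>i. emp N x i - pmf p i"] by linarith
      then show False using le[OF assms(5)] \<beta> by simp
    qed
    \<comment> \<open>On one point \<open>p = q\<close>, so the separation would be 0 although it is
      at least \<open>2 * tauN' N \<alpha> > 0\<close>.\<close>
    have "n \<noteq> 1"
    proof
      assume "n = 1"
      then have "p = return_pmf 1" "q = return_pmf 1"
        using assms(5,6) by (simp_all flip: set_pmf_subset_singleton)
      then show False using sep tau \<open>r \<ge> 0\<close> lpnorm_zero[OF assms(2) n] by (simp add: r_def)
    qed
    then have r: "r > 0"
      using n \<beta> assms(1,2) bound by (intro deviation_bound_pos[of N pp n \<beta>]) (auto simp: r_def)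
    define E1 where "E1 = {x. lpnorm n pp (\<lambda>i. emp N x i - pmf p i) > r}"
    define E2 where "E2 = {y. lpnorm n pp (\<lambda>i. emp N y i - pmf q i) > r}"
    \<comment> \<open>A deviation of the first test sample to \<open>- r\<close> or below is an
      upward deviation for the vector \<open>- e\<close>, which has the same norm.\<close>
    define F1 where "F1 = (\<lambda>a. {x. (\<Sum>i=1..n. - e (fst a) (snd a) i * (emp N x i - pmf p i)) \<ge> r})"
    define F2 where "F2 = (\<lambda>a. {y. (\<Sum>i=1..n. e (fst a) (snd a) i * (emp N y i - pmf q i)) \<ge> r})"
    \<comment> \<open>Four bad events, each of probability at most \<open>\<beta>\<close>:
      \<open>B1\<close> and \<open>B2\<close> concern the training samples, \<open>B3\<close> and
      \<open>B4\<close> the test samples through a vector that depends on the training pair.\<close>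
    define B1 B2 B3 B4 :: "(((nat \<Rightarrow> nat) \<times> (nat \<Rightarrow> nat)) \<times> ((nat \<Rightarrow> nat) \<times> (nat \<Rightarrow> nat))) set"
      where "B1 = {z. fst (fst z) \<in> E1}" and "B2 = {z. snd (fst z) \<in> E2}"
      and "B3 = {z. fst (snd z) \<in> F1 (fst z)}" and "B4 = {z. snd (snd z) \<in> F2 (fst z)}"
    note B_defs = B1_def B2_def B3_def B4_def
    have fstM: "measure_pmf.prob M {z. fst z \<in> S} = measure_pmf.prob (sample_pmf N p) S"
      and sndM: "measure_pmf.prob M {z. snd z \<in> S} = measure_pmf.prob (sample_pmf N q) S" for S
      using measure_map_pmf[of fst M S] measure_map_pmf[of snd M S]
      by (simp_all add: M_def map_fst_pair_pmf map_snd_pair_pmf vimage_def)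
    have fstMM: "measure_pmf.prob (pair_pmf M M) {z. fst z \<in> S} = measure_pmf.prob M S" for S
      using measure_map_pmf[of fst "pair_pmf M M" S] by (simp add: map_fst_pair_pmf vimage_def)
    \<comment> \<open>\<open>e_choice\<close> constrains \<open>e\<close> only on samples with
      values in {1..n}; every training pair of positive probability consists of such
      samples.\<close>
    have range: "fst a ` {..<N} \<subseteq> {1..n}" "snd a ` {..<N} \<subseteq> {1..n}" if "a \<in> set_pmf M" for a
    proof -
      have "fst a \<in> set_pmf (sample_pmf N p)" "snd a \<in> set_pmf (sample_pmf N q)"
        using that by (auto simp: M_def)
      then show "fst a ` {..<N} \<subseteq> {1..n}" "snd a ` {..<N} \<subseteq> {1..n}"
        using sample_pmf_range assms(5,6) by blast+
    qed
    have u: "lpnorm n (conj_exp pp) (e (fst a) (snd a)) = 1" if "a \<in> set_pmf M" for a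
      using e_choice[OF range[OF that]] by simp
    have "measure_pmf.prob (pair_pmf M M) B1 \<le> \<beta>"
      using le[OF assms(5)] fstMM[of "{z. fst z \<in> E1}"] fstM[of E1] by (simp add: B1_def E1_def)
    moreover have "measure_pmf.prob (pair_pmf M M) B2 \<le> \<beta>"
      using le[OF assms(6)] fstMM[of "{z. snd z \<in> E2}"] sndM[of E2] by (simp add: B2_def E2_def)
    moreover have "measure_pmf.prob (pair_pmf M M) B3 \<le> \<beta>"
    proof (rule prob_pair_pmf_le)
      fix a assume a: "a \<in> set_pmf M"
      have "measure_pmf.prob (sample_pmf N p) (F1 a) \<le> \<beta>"
        unfolding F1_def using assms(1,2,5) r u[OF a] bound
        by (intro prob_linear_deviation_ge[of _ pp]) (auto simp: lpnorm_uminus r_def)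
      then show "measure_pmf.prob M {b. (a, b) \<in> B3} \<le> \<beta>" by (simp add: B3_def fstM)
    qed (use \<beta> in auto)
    moreover have "measure_pmf.prob (pair_pmf M M) B4 \<le> \<beta>"
    proof (rule prob_pair_pmf_le)
      fix a assume a: "a \<in> set_pmf M"
      have "measure_pmf.prob (sample_pmf N q) (F2 a) \<le> \<beta>"
        unfolding F2_def using assms(1,2,6) r u[OF a] bound
        by (intro prob_linear_deviation_ge[of _ pp]) (auto simp: r_def)
      then show "measure_pmf.prob M {b. (a, b) \<in> B4} \<le> \<beta>" by (simp add: B4_def sndM)
    qed (use \<beta> in auto)
    moreover have "measure_pmf.prob (pair_pmf M M) {z. \<not> claim z} \<le>
        measure_pmf.prob (pair_pmf M M) ((B1 \<union> B2) \<union> (B3 \<union> B4))"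
    proof (rule measure_pmf.finite_measure_mono_AE)
      \<comment> \<open>On the support, the test claims H1 outside the bad events; the union bound
        then gives 4 \<beta>.\<close>
      show "AE z in pair_pmf M M. z \<in> {z. \<not> claim z} \<longrightarrow> z \<in> (B1 \<union> B2) \<union> (B3 \<union> B4)"
      proof (intro AE_pmfI impI, rule ccontr)
        fix z assume z: "z \<in> set_pmf (pair_pmf M M)" "z \<in> {z. \<not> claim z}" "z \<notin> (B1 \<union> B2) \<union> (B3 \<union> B4)"
        obtain x y x' y' where zeq: "z = ((x, y), (x', y'))" by (metis surj_pair)
        have ex: "(\<Sum>i=1..n. e x y i * (emp N x i - emp N y i)) = lpnorm n pp (\<lambda>i. emp N x i - emp N y i)"
          "lpnorm n (conj_exp pp) (e x y) = 1"
          using e_choice[of x y] range[of "(x, y)"] z(1) by (auto simp: zeq)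
        have "test_stat n N (e x y) x' y' > 2 * tauN' N \<alpha>"
          using z(3) tau n sep
          by (intro test_stat_gt[OF assms(2) _ _ ex, of _ p r q])
             (auto simp: zeq B_defs E1_def E2_def F1_def F2_def r_def sum_negf)
        then show False using z(2) by (simp add: zeq claim_def)
      qed
    qed auto
    moreover have sub: "measure_pmf.prob (pair_pmf M M) (S \<union> S') \<le>
        measure_pmf.prob (pair_pmf M M) S + measure_pmf.prob (pair_pmf M M) S'" for S S'
      by (intro measure_subadditive) auto
    ultimately show ?thesis
      using sub[of "B1 \<union> B2" "B3 \<union> B4"] sub[of B1 B2] sub[of B3 B4] by linarith
  qed
  ultimately show ?thesis
    unfolding prob_claim prob_not_claim deviation_bound_def by auto
qed

end
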